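(* Let $X$ be a (real or complex) Banach space with a Schauder basis $(x_n)_{n\ge 1}$ and let $C=\{\sum_{j=1}^\infty t_j x_j \in X : t_j\ge 0 \text{ for all } j\}$. Let $T=(T_1,\dots,T_N)$ be an $N$-tuple of continuous linear operators on $X$ (not necessarily commuting) which is positive with respect to the cone $C$. Suppose that there exists $y_0\in C$, $y_0\neq 0$, such that $T=(T_1,\dots,T_N)$ is joint locally quasinilpotent at $y_0$. Then there exists a common nontrivial invariant subspace for $T_1,\dots,T_N$.
   Context: A Schauder basis $(x_n)_{n\ge1}$ is an infinite sequence, so $X$ is infinite-dimensional; elements of $C$ are the norm-convergent series $\sum_{j=1}^\infty t_jx_j$ with all $t_j\ge 0$. The tuple $T=(T_1,\dots,T_N)$ is positive with respect to $C$ if $T_j(C)\subset C$ for all $j\in\{1,\dots,N\}$. The tuple $T=(T_1,\dots,T_N)$ is joint locally quasinilpotent at $x_0\in X$ if for every sequence $(i_j)_{j\ge1}$ with $i_j\in\{1,\dots,N\}$, $$\lim_{n\to\infty}\|T_{i_1}T_{i_2}\cdots T_{i_n}x_0\|^{1/n}=0.$$ (No uniformity over the sequences $(i_j)$ is required.) A common nontrivial invariant subspace for $T_1,\dots,T_N$ is a closed linear subspace $M\subset X$ with $M\ne\{0\}$, $M\neq X$ and $T_j(M)\subset M$ for all $j\in\{1,\dots,N\}$. *)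

theory Defs
  imports "HOL-Analysis.Analysis"
begin

text \<open>The scalar field: every model of this class is isometrically isomorphic to the reals or to
  the complex numbers with their usual absolute value, and both are instances.\<close>

class real_or_complex = real_normed_field +
  assumes real_or_complex:
    "(\<forall>z. \<exists>a. z = a *\<^sub>R 1) \<or>
     (\<exists>i. i * i = - 1 \<and> (\<forall>z. \<exists>a b. z = a *\<^sub>R 1 + b *\<^sub>R i) \<and>
          (\<forall>a b. norm (a *\<^sub>R 1 + b *\<^sub>R i) = sqrt (a\<^sup>2 + b\<^sup>2)))"

instance real :: real_or_complex
  by standard simp

instance complex :: real_or_complex
proof
  have "\<i> * \<i> = - 1 \<and> (\<forall>z. \<exists>a b. z = a *\<^sub>R 1 + b *\<^sub>R \<i>) \<and>
    (\<forall>a b. norm (a *\<^sub>R 1 + b *\<^sub>R \<i>) = sqrt (a\<^sup>2 + b\<^sup>2))"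
  proof (intro conjI allI)
    fix z :: complex
    have "z = Re z *\<^sub>R 1 + Im z *\<^sub>R \<i>" by (simp add: complex_eq_iff)
    then show "\<exists>a b. z = a *\<^sub>R 1 + b *\<^sub>R \<i>" by blast
  qed (simp_all add: cmod_def)
  then show "(\<forall>z::complex. \<exists>a. z = a *\<^sub>R 1) \<or>
     (\<exists>i::complex. i * i = - 1 \<and> (\<forall>z. \<exists>a b. z = a *\<^sub>R 1 + b *\<^sub>R i) \<and>
          (\<forall>a b. norm (a *\<^sub>R 1 + b *\<^sub>R i) = sqrt (a\<^sup>2 + b\<^sup>2)))"
    by blast
qed

text \<open>A normed space over the scalar field \<open>'k\<close>. The norm, the topology and the real scalar
  multiplication are those of the type class; \<open>smul_of_real\<close> makes \<open>smul\<close> extend the latter.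
  Completeness comes from the class \<open>banach\<close>.\<close>

locale normed_space_over = vector_space smul
  for smul :: "'k::real_or_complex \<Rightarrow> 'a::real_normed_vector \<Rightarrow> 'a" +
  assumes smul_of_real: "smul (of_real r) x = r *\<^sub>R x"
    and norm_smul: "norm (smul c x) = norm c * norm x"

lemma normed_space_over_scaleR:
  "normed_space_over ((*\<^sub>R) :: real \<Rightarrow> 'a::real_normed_vector \<Rightarrow> 'a)"
  by unfold_locales (simp_all add: algebra_simps)

text \<open>Sequences of basis vectors are indexed from 0.\<close>

definition schauder_basis ::
  "('k::real_or_complex \<Rightarrow> 'a::real_normed_vector \<Rightarrow> 'a) \<Rightarrow> (nat \<Rightarrow> 'a) \<Rightarrow> bool" where
  "schauder_basis smul x \<longleftrightarrow>
    (\<forall>v. \<exists>!t :: nat \<Rightarrow> 'k. (\<lambda>n. smul (t n) (x n)) sums v)"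

definition basis_cone :: "(nat \<Rightarrow> 'a::real_normed_vector) \<Rightarrow> 'a set" where
  "basis_cone x = {v. \<exists>t :: nat \<Rightarrow> real. (\<forall>n. 0 \<le> t n) \<and> (\<lambda>n. t n *\<^sub>R x n) sums v}"

text \<open>An \<open>N\<close>-tuple of operators is a function \<open>T\<close> of which only \<open>T 1\<close>, ..., \<open>T N\<close> matter.\<close>

definition positive_tuple :: "nat \<Rightarrow> (nat \<Rightarrow> 'a \<Rightarrow> 'a) \<Rightarrow> 'a set \<Rightarrow> bool" where
  "positive_tuple N T C \<longleftrightarrow> (\<forall>j\<in>{1..N}. T j ` C \<subseteq> C)"

text \<open>\<open>foldr T (map i [1..<Suc n]) x0\<close> is \<open>T (i 1) (T (i 2) (... (T (i n) x0)))\<close>.\<close>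

definition joint_locally_quasinilpotent ::
  "nat \<Rightarrow> (nat \<Rightarrow> 'a::real_normed_vector \<Rightarrow> 'a) \<Rightarrow> 'a \<Rightarrow> bool" where
  "joint_locally_quasinilpotent N T x0 \<longleftrightarrow>
    (\<forall>i :: nat \<Rightarrow> nat. (\<forall>j\<ge>1. i j \<in> {1..N}) \<longrightarrow>
      (\<lambda>n. root n (norm (foldr T (map i [1..<Suc n]) x0))) \<longlonglongrightarrow> 0)"

definition common_nontrivial_invariant_subspace ::
  "('k::real_or_complex \<Rightarrow> 'a::real_normed_vector \<Rightarrow> 'a) \<Rightarrow> nat \<Rightarrow> (nat \<Rightarrow> 'a \<Rightarrow> 'a) \<Rightarrow> 'a set \<Rightarrow> bool"
  where
  "common_nontrivial_invariant_subspace smul N T M \<longleftrightarrow>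
    closed M \<and> module.subspace smul M \<and> M \<noteq> {0} \<and> M \<noteq> UNIV \<and> (\<forall>j\<in>{1..N}. T j ` M \<subseteq> M)"

end

theory Submission
  imports Defs
begin

text \<open>
  Write \<open>f\<^sub>k\<close> for the coordinate functionals of the basis and choose \<open>k\<close> with \<open>f\<^sub>k(y\<^sub>0) = c > 0\<close>.
  Order the space by the cone, so that \<open>y\<^sub>0 \<ge> c x\<^sub>k\<close>. Let \<open>A\<close> be the product of the operators along
  a nonempty finite word. Then \<open>A\<close> is positive, so \<open>A x\<^sub>k \<ge> a x\<^sub>k\<close> with \<open>a = f\<^sub>k(A x\<^sub>k) \<ge> 0\<close>, and
  iteration gives \<open>A\<^sup>m y\<^sub>0 \<ge> c a\<^sup>m x\<^sub>k\<close>, that is, \<open>f\<^sub>k(A\<^sup>m y\<^sub>0) \<ge> c a\<^sup>m\<close>. Since \<open>f\<^sub>k\<close> is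
  continuous, \<open>a > 0\<close> would force the norm of \<open>A\<^sup>m y\<^sub>0\<close> to decay at most geometrically. But
  quasinilpotence along the periodic sequence that repeats the word makes it decay faster than
  every geometric sequence. Hence \<open>f\<^sub>k(A x\<^sub>k) = 0\<close> for every such product (lemma
  \<open>diagonal_coord_zero\<close>).

  The set \<open>M\<close> of all \<open>v\<close> with \<open>f\<^sub>k(A v) = 0\<close> for every product \<open>A\<close> along a nonempty word is
  therefore a closed subspace that contains \<open>x\<^sub>k\<close>. It is invariant because lengthening a word by one
  letter at its right end gives another word. If \<open>M\<close> is the whole space, then every operator maps
  into the kernel of \<open>f\<^sub>k\<close>. This kernel is then invariant; it contains \<open>x\<^sub>k\<^sub>+\<^sub>1\<close> and omits \<open>x\<^sub>k\<close>.

  The analytic ingredient is the continuity of the \<open>f\<^sub>k\<close> (lemma \<open>coord_bounded_linear\<close>). It comes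
  from Zabreiko's lemma, a consequence of the Baire category theorem, applied to the norm
  \<open>p(v) = sup\<^sub>n \<parallel>\<Sum>\<^sub>i\<^sub><\<^sub>n f\<^sub>i(v) x\<^sub>i\<parallel>\<close>.
\<close>

section \<open>Countably subadditive seminorms\<close>

text \<open>
  Zabreiko's lemma. The sublevel sets of \<open>p\<close> cover the space, so by Baire's theorem one of them is
  dense in some ball; differences of its points then approximate every vector near \<open>0\<close>. By
  homogeneity every \<open>v\<close> is approximated within \<open>\<parallel>v\<parallel> / 2\<close> by some \<open>h v\<close> with
  \<open>p (h v) \<le> K \<parallel>v\<parallel>\<close>. Approximating the successive remainders writes \<open>v\<close> as a series whose
  \<open>p\<close>-values are dominated by a geometric series, and countable subadditivity sums them up.
\<close>
lemma countably_subadditive_bounded: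
  fixes p :: "'a::banach \<Rightarrow> real"
  assumes scale: "\<And>c v. p (c *\<^sub>R v) \<le> \<bar>c\<bar> * p v"
    and csub: "\<And>w v. w sums v \<Longrightarrow> summable (\<lambda>j. p (w j)) \<Longrightarrow> p v \<le> (\<Sum>j. p (w j))"
  shows "\<exists>K. \<forall>v. p v \<le> K * norm v"
proof -
  have p00: "p 0 = 0"
    using scale[of 2 0] scale[of 0 0] by simp
  (* Ordinary subadditivity is countable subadditivity for u + v + 0 + 0 + ... *)
  have sub: "p (u + v) \<le> p u + p v" for u v
  proof -
    define w where "w = (\<lambda>j::nat. if j = 0 then u else if j = 1 then v else 0)"
    have "w sums (\<Sum>j\<in>{0,1}. w j)" by (rule sums_finite) (auto simp: w_def)
    moreover have sp: "(\<lambda>j. p (w j)) sums (\<Sum>j\<in>{0,1}. p (w j))"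
      by (rule sums_finite) (auto simp: w_def p00)
    ultimately have "p (\<Sum>j\<in>{0,1}. w j) \<le> (\<Sum>j\<in>{0,1}. p (w j))"
      using csub sums_summable sums_unique by metis
    then show ?thesis by (simp add: w_def p00)
  qed
  have neg: "p (- v) \<le> p v" for v using scale[of "-1" v] by simp
  have nonneg: "0 \<le> p v" for v using sub[of v "-v"] neg[of v] p00 by simp
  define A where "A = (\<lambda>m::nat. {v. p v \<le> real m})"
  have "\<exists>m. interior (closure (A m)) \<noteq> {}"
  proof (rule ccontr)
    assume "\<nexists>m. interior (closure (A m)) \<noteq> {}"
    then have "euclidean interior_of \<Union>(range (\<lambda>m. closure (A m))) = {}"
      by (intro Baire_category_alt) (auto simp: completely_metrizable_space_euclidean)
    moreover have "v \<in> \<Union>(range (\<lambda>m. closure (A m)))" for v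
    proof -
      obtain m where "p v \<le> real m" using real_arch_simple by blast
      then have "v \<in> closure (A m)" using closure_subset[of "A m"] by (auto simp: A_def)
      then show ?thesis by blast
    qed
    then have "\<Union>(range (\<lambda>m. closure (A m))) = UNIV" by blast
    ultimately show False by simp
  qed
  then obtain m a where "a \<in> interior (closure (A m))" by blast
  then obtain r where r: "r > 0" "ball a r \<subseteq> closure (A m)"
    by (meson interior_subset open_contains_ball_eq open_interior subset_trans)
  have near: "\<exists>b. norm (v - b) < e \<and> p b \<le> 2 * real m" if v: "norm v < r" and e: "e > 0" for v e
  proof -
    have "a + v \<in> closure (A m)" "a \<in> closure (A m)"
      using r v by (auto simp: subset_iff dist_norm)
    then obtain b1 b2 where b: "b1 \<in> A m" "dist b1 (a + v) < e / 2" "b2 \<in> A m" "dist b2 a < e / 2"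
      using e unfolding closure_approachable by (meson half_gt_zero)
    have "v - (b1 - b2) = (b2 - a) - (b1 - (a + v))" by simp
    then have "norm (v - (b1 - b2)) \<le> norm (b2 - a) + norm (b1 - (a + v))"
      by (metis norm_triangle_ineq4)
    also have "\<dots> < e" using b by (simp add: dist_norm)
    finally have "norm (v - (b1 - b2)) < e" .
    moreover have "p (b1 - b2) \<le> 2 * real m"
      using sub[of b1 "-b2"] neg[of b2] b by (simp add: A_def)
    ultimately show ?thesis by blast
  qed
  (* For nonzero v, near is applied to v scaled down to norm r/2, with error r/4; scaling back by
     2 * norm v / r turns the error into norm v / 2 and the bound 2 * m into K * norm v. *)
  define K where "K = 4 * real m / r"
  have "\<exists>b. norm (v - b) \<le> norm v / 2 \<and> p b \<le> K * norm v" for v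
  proof (cases "v = 0")
    case True
    then show ?thesis using p00 by (intro exI[of _ 0]) simp
  next
    case False
    define c where "c = r / (2 * norm v)"
    have c: "c > 0" "norm (c *\<^sub>R v) < r" "inverse c = 2 * norm v / r"
      using False r by (simp_all add: c_def)
    obtain b where b: "norm (c *\<^sub>R v - b) < r / 4" "p b \<le> 2 * real m"
      using near[OF c(2), of "r/4"] r by auto
    have "norm (v - inverse c *\<^sub>R b) = inverse c * norm (c *\<^sub>R v - b)"
    proof -
      have "v - inverse c *\<^sub>R b = inverse c *\<^sub>R (c *\<^sub>R v - b)"
        using c(1) by (simp add: scaleR_diff_right)
      then show ?thesis using c(1) by simp
    qed
    also have "\<dots> \<le> inverse c * (r / 4)" using b(1) c(1) by (intro mult_left_mono) auto
    also have "\<dots> = norm v / 2" using c r by simp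
    finally have "norm (v - inverse c *\<^sub>R b) \<le> norm v / 2" .
    moreover have "p (inverse c *\<^sub>R b) \<le> K * norm v"
    proof -
      have "p (inverse c *\<^sub>R b) \<le> inverse c * p b" using scale[of "inverse c" b] c(1) by simp
      also have "\<dots> \<le> inverse c * (2 * real m)" using b(2) c(1) by (intro mult_left_mono) auto
      finally show ?thesis using c(3) by (simp add: K_def mult_ac)
    qed
    ultimately show ?thesis by blast
  qed
  then have "\<exists>h. \<forall>v. norm (v - h v) \<le> norm v / 2 \<and> p (h v) \<le> K * norm v"
    by (intro choice allI)
  then obtain h where h: "\<And>v. norm (v - h v) \<le> norm v / 2" "\<And>v. p (h v) \<le> K * norm v"
    by blast
  have "p v \<le> 2 * K * norm v" for v
  proof -
    (* R n is what remains of v after n approximation steps; the step to R (Suc n)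
       removes h (R n). *)
    define R where "R = (\<lambda>n. ((\<lambda>u. u - h u) ^^ n) v)"
    have R: "norm (R n) \<le> norm v * (1/2) ^ n" for n
    proof (induction n)
      case (Suc n)
      have "norm (R (Suc n)) \<le> norm (R n) / 2" using h(1)[of "R n"] by (simp add: R_def)
      then show ?case using Suc by simp
    qed (simp add: R_def)
    have geo: "(\<lambda>n. c * (1/2::real) ^ n) sums (c * 2)" for c
      using sums_mult[OF geometric_sums[of "1/2::real"], of c] by simp
    have "R \<longlonglongrightarrow> 0"
      by (rule Lim_null_comparison[OF _ summable_LIMSEQ_zero[OF sums_summable[OF geo[of "norm v"]]]])
        (use R in auto)
    from telescope_sums'[OF this] have S: "(\<lambda>n. h (R n)) sums v" by (simp add: R_def)
    have "K \<ge> 0" using r by (simp add: K_def)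
    have le: "p (h (R n)) \<le> (K * norm v) * (1/2) ^ n" for n
      using order_trans[OF h(2) mult_left_mono[OF R \<open>K \<ge> 0\<close>]] by (simp add: mult_ac)
    have sp: "summable (\<lambda>n. p (h (R n)))"
      by (rule summable_comparison_test'[OF sums_summable[OF geo[of "K * norm v"]]])
        (use le nonneg in auto)
    have "p v \<le> (\<Sum>n. p (h (R n)))" by (rule csub[OF S sp])
    also have "\<dots> \<le> (\<Sum>n. (K * norm v) * (1/2) ^ n)"
      by (rule suminf_le[OF le sp sums_summable[OF geo]])
    also have "\<dots> = 2 * K * norm v" using sums_unique[OF geo[of "K * norm v"]] by simp
    finally show ?thesis .
  qed
  then show ?thesis by blast
qed

section \<open>Continuity of the coordinate functionals\<close>

text \<open>
  The scalar class does not include completeness, but its axiom expresses every scalar by at most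
  two real coordinates, each bounded by the norm, and the real line is complete.
\<close>
lemma real_or_complex_summable_norm_cancel:
  fixes f :: "nat \<Rightarrow> 'k::real_or_complex"
  assumes "summable (\<lambda>n. norm (f n))"
  shows "summable f"
proof -
  have "\<exists>i a b. (\<forall>z::'k. z = a z *\<^sub>R 1 + b z *\<^sub>R i \<and> \<bar>a z\<bar> \<le> norm z \<and> \<bar>b z\<bar> \<le> norm z)"
    using real_or_complex
  proof
    assume "\<forall>z::'k. \<exists>a. z = a *\<^sub>R 1"
    then obtain a where a: "\<And>z::'k. z = a z *\<^sub>R 1" by metis
    have "\<bar>a z\<bar> = norm z" for z using arg_cong[OF a[of z], of norm] by simp
    with a show ?thesis by (intro exI[of _ 0] exI[of _ a] exI[of _ "\<lambda>_. 0"]) simp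
  next
    assume "\<exists>i::'k. i * i = - 1 \<and> (\<forall>z. \<exists>a b. z = a *\<^sub>R 1 + b *\<^sub>R i) \<and>
          (\<forall>a b. norm (a *\<^sub>R 1 + b *\<^sub>R i) = sqrt (a\<^sup>2 + b\<^sup>2))"
    then obtain i :: 'k and a b where ab: "\<And>z. z = a z *\<^sub>R 1 + b z *\<^sub>R i"
      and n: "\<And>a b. norm (a *\<^sub>R 1 + b *\<^sub>R i) = sqrt (a\<^sup>2 + b\<^sup>2)" by metis
    have "norm z = sqrt ((a z)\<^sup>2 + (b z)\<^sup>2)" for z using n ab by metis
    with ab show ?thesis
      by (intro exI[of _ i] exI[of _ a] exI[of _ b]) (simp add: real_sqrt_ge_abs1 real_sqrt_ge_abs2)
  qed
  then obtain i a b where z: "\<And>z::'k. z = a z *\<^sub>R 1 + b z *\<^sub>R i"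
    "\<And>z. \<bar>a z\<bar> \<le> norm z" "\<And>z. \<bar>b z\<bar> \<le> norm z" by metis
  have "summable (\<lambda>n. a (f n))" "summable (\<lambda>n. b (f n))"
    by (rule summable_comparison_test'[OF assms]; simp add: z)+
  then have "summable (\<lambda>n. a (f n) *\<^sub>R 1 + b (f n) *\<^sub>R i)"
    by (intro summable_add bounded_linear.summable[OF bounded_linear_scaleR_left])
  then show ?thesis using z(1) by simp
qed

context normed_space_over
begin

lemma bounded_linear_smul_right: "bounded_linear (smul c)"
proof (rule bounded_linear_intro)
  show "smul c (r *\<^sub>R u) = r *\<^sub>R smul c u" for r u
    by (metis smul_of_real scale_left_commute)
  show "norm (smul c u) \<le> norm u * norm c" for u by (simp add: norm_smul)
qed (rule scale_right_distrib)

lemma bounded_linear_smul_left: "bounded_linear (\<lambda>c. smul c u)"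
proof (rule bounded_linear_intro)
  show "smul (r *\<^sub>R c) u = r *\<^sub>R smul c u" for r c
    by (metis smul_of_real scale_scale scaleR_conv_of_real)
qed (auto simp: norm_smul scale_left_distrib)

end

locale banach_space_with_basis = normed_space_over smul
  for smul :: "'k::real_or_complex \<Rightarrow> 'a::banach \<Rightarrow> 'a" +
  fixes x :: "nat \<Rightarrow> 'a"
  assumes basis: "schauder_basis smul x"
begin

definition coord :: "'a \<Rightarrow> nat \<Rightarrow> 'k" where
  "coord v = (THE t. (\<lambda>n. smul (t n) (x n)) sums v)"

lemma sums_coord: "(\<lambda>n. smul (coord v n) (x n)) sums v"
proof -
  have "\<exists>!t. (\<lambda>n. smul (t n) (x n)) sums v"
    using basis by (simp add: schauder_basis_def)
  from theI'[OF this] show ?thesis by (simp add: coord_def)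
qed

lemma coord_eqI: "(\<lambda>n. smul (t n) (x n)) sums v \<Longrightarrow> coord v = t"
  using basis sums_coord[of v] unfolding schauder_basis_def by blast

lemma coord_add: "coord (u + v) = (\<lambda>n. coord u n + coord v n)"
  by (rule coord_eqI) (use sums_add[OF sums_coord sums_coord] in \<open>simp add: scale_left_distrib\<close>)

lemma coord_smul: "coord (smul c v) = (\<lambda>n. c * coord v n)"
  by (rule coord_eqI)
    (use bounded_linear.sums[OF bounded_linear_smul_right sums_coord] in simp)

lemma coord_scaleR: "coord (r *\<^sub>R v) = (\<lambda>n. r *\<^sub>R coord v n)"
  using coord_smul[of "of_real r" v] by (simp add: smul_of_real scaleR_conv_of_real)

lemma coord_diff: "coord (u - v) = (\<lambda>n. coord u n - coord v n)"
  using coord_add[of u "(-1) *\<^sub>R v"] coord_scaleR[of "-1" v] by simp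

lemma coord_basis: "coord (x k) = (\<lambda>n. if n = k then 1 else 0)"
proof (rule coord_eqI)
  show "(\<lambda>n. smul (if n = k then 1 else 0) (x n)) sums x k"
    using sums_finite[of "{k}" "\<lambda>n. smul (if n = k then 1 else 0) (x n)"] by simp
qed

lemma basis_nonzero: "x k \<noteq> 0"
proof
  assume "x k = 0"
  then have "coord (x k) = (\<lambda>_. 0)" by (intro coord_eqI) simp
  then have "coord (x k) k = 0" by simp
  then show False by (simp add: coord_basis)
qed

text \<open>
  Let \<open>p v\<close> be the supremum of the norms of the partial sums of the expansion of \<open>v\<close>. It dominates
  \<open>norm v\<close> and, up to a constant, each coordinate of \<open>v\<close>, so by Zabreiko's lemma it is enough that
  \<open>p\<close> is countably subadditive. If \<open>w\<close> sums to \<open>v\<close> and the \<open>p (w j)\<close> are summable, then the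
  coordinates of the \<open>w j\<close> can be summed over \<open>j\<close>. The expansion with these summed coordinates
  converges to \<open>v\<close>, because the limit of its partial sums may be exchanged with the sum over \<open>j\<close>, so
  by uniqueness of expansions it is the expansion of \<open>v\<close>. Hence the partial sums of \<open>v\<close> are the sums
  over \<open>j\<close> of those of \<open>w j\<close>, which is countable subadditivity.
\<close>
lemma coord_bounded_linear: "bounded_linear (\<lambda>v. coord v k)"
proof -
  define S where "S = (\<lambda>n v. \<Sum>i<n. smul (coord v i) (x i))"
  define p where "p = (\<lambda>v. SUP n. norm (S n v))"
  have S_lim: "(\<lambda>n. S n v) \<longlonglongrightarrow> v" for v
    using sums_coord[of v] by (simp add: sums_def S_def)
  have S_le: "norm (S n v) \<le> p v" for n v
  proof -
    have "Bseq (\<lambda>n. S n v)" by (rule convergent_imp_Bseq) (use S_lim convergent_def in blast)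
    then obtain B where "\<And>n. norm (S n v) \<le> B" by (auto simp: Bseq_def)
    then have "bdd_above (range (\<lambda>n. norm (S n v)))" by (rule bdd_aboveI2)
    then show ?thesis unfolding p_def by (intro cSUP_upper) auto
  qed
  have norm_le: "norm v \<le> p v" for v
    by (rule LIMSEQ_le_const2[OF tendsto_norm[OF S_lim]]) (use S_le in auto)
  have coord_le: "norm (coord v i) * norm (x i) \<le> 2 * p v" for v i
  proof -
    have "smul (coord v i) (x i) = S (Suc i) v - S i v" by (simp add: S_def)
    then have "norm (coord v i) * norm (x i) \<le> norm (S (Suc i) v) + norm (S i v)"
      by (metis norm_smul norm_triangle_ineq4)
    then show ?thesis using S_le[of "Suc i" v] S_le[of i v] by linarith
  qed
  have scale: "p (c *\<^sub>R v) \<le> \<bar>c\<bar> * p v" for c v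
  proof -
    have "S n (c *\<^sub>R v) = c *\<^sub>R S n v" for n
      by (simp add: S_def coord_scaleR scaleR_sum_right
          linear_cmul[OF bounded_linear.linear[OF bounded_linear_smul_left]])
    then have "norm (S n (c *\<^sub>R v)) \<le> \<bar>c\<bar> * p v" for n
      using S_le[of n v] by (simp add: mult_left_mono)
    then show ?thesis unfolding p_def by (intro cSUP_least) auto
  qed
  have csub: "p v \<le> (\<Sum>j. p (w j))" if w: "w sums v" and sp: "summable (\<lambda>j. p (w j))" for w v
  proof -
    define s where "s = (\<lambda>i. \<Sum>j. coord (w j) i)"
    have "summable (\<lambda>j. coord (w j) i)" for i
    proof (rule real_or_complex_summable_norm_cancel, rule summable_comparison_test')
      show "summable (\<lambda>j. 2 / norm (x i) * p (w j))" using sp by (rule summable_mult)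
      show "norm (norm (coord (w j) i)) \<le> 2 / norm (x i) * p (w j)" for j
        using coord_le[of "w j" i] basis_nonzero[of i] by (simp add: field_simps)
    qed
    then have "(\<lambda>j. coord (w j) i) sums s i" for i by (simp add: s_def summable_sums)
    then have "(\<lambda>j. smul (coord (w j) i) (x i)) sums smul (s i) (x i)" for i
      by (rule bounded_linear.sums[OF bounded_linear_smul_left])
    then have SA: "(\<lambda>j. S n (w j)) sums (\<Sum>i<n. smul (s i) (x i))" for n
      unfolding S_def by (rule sums_sum)
    have diff: "norm (S n (w j) - w j) \<le> 2 * p (w j)" for n j
      using norm_triangle_ineq4[of "S n (w j)" "w j"] S_le[of n "w j"] norm_le[of "w j"] by linarith
    have sd: "summable (\<lambda>j. norm (S n (w j) - w j))" for n
      by (rule summable_comparison_test'[OF summable_mult[OF sp, of 2]]) (use diff in simp)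
    (* Dominated convergence for series: the n-th term is bounded by 2 * p (w j), uniformly in n. *)
    have "(\<lambda>n. \<Sum>j. norm (S n (w j) - w j)) \<longlonglongrightarrow> (\<Sum>j. 0)"
    proof (rule tannerys_theorem[THEN conjunct2, THEN conjunct2])
      show "(\<lambda>n. norm (S n (w j) - w j)) \<longlonglongrightarrow> 0" for j
        using S_lim[of "w j"] by (simp add: LIM_zero_iff tendsto_norm_zero_iff)
      show "summable (\<lambda>j. 2 * p (w j))" using sp by (rule summable_mult)
      show "\<forall>\<^sub>F (j, n) in sequentially \<times>\<^sub>F sequentially.
          norm (norm (S n (w j) - w j)) \<le> 2 * p (w j)"
        by (rule always_eventually) (use diff in auto)
    qed simp
    then have "(\<lambda>n. (\<Sum>i<n. smul (s i) (x i)) - v) \<longlonglongrightarrow> 0"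
    proof (rule Lim_null_comparison[rotated, OF tendsto_eq_rhs])
      have "norm ((\<Sum>i<n. smul (s i) (x i)) - v) \<le> (\<Sum>j. norm (S n (w j) - w j))" for n
        using summable_norm[OF sd] sums_unique[OF sums_diff[OF SA w]] by simp
      then show "\<forall>\<^sub>F n in sequentially.
        norm ((\<Sum>i<n. smul (s i) (x i)) - v) \<le> (\<Sum>j. norm (S n (w j) - w j))" by simp
    qed simp
    then have "(\<lambda>i. smul (s i) (x i)) sums v" by (simp add: sums_def LIM_zero_iff)
    then have "coord v = s" by (rule coord_eqI)
    then have "S n v = (\<Sum>j. S n (w j))" for n using sums_unique[OF SA] by (simp add: S_def)
    then have "norm (S n v) \<le> (\<Sum>j. p (w j))" for n
      using norm_suminf_le[of "\<lambda>j. S n (w j)", OF S_le sp] by simp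
    then show ?thesis unfolding p_def by (intro cSUP_least) auto
  qed
  obtain K where K: "\<And>v. p v \<le> K * norm v"
    using countably_subadditive_bounded[of p, OF scale csub] by blast
  show ?thesis
  proof (rule bounded_linear_intro)
    show "norm (coord v k) \<le> norm v * (2 * K / norm (x k))" for v
      using coord_le[of v k] K[of v] basis_nonzero[of k] by (simp add: field_simps)
  qed (simp_all add: coord_add coord_scaleR)
qed

section \<open>The positive cone of a Schauder basis\<close>

lemma basis_cone_iff:
  "v \<in> basis_cone x \<longleftrightarrow> (\<exists>t. (\<forall>n. 0 \<le> t n) \<and> coord v = (\<lambda>n. of_real (t n)))"
proof
  assume "v \<in> basis_cone x"
  then obtain t where t: "\<forall>n. 0 \<le> t n" "(\<lambda>n. t n *\<^sub>R x n) sums v" by (auto simp: basis_cone_def)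
  then have "coord v = (\<lambda>n. of_real (t n))" by (intro coord_eqI) (simp add: smul_of_real)
  with t show "\<exists>t. (\<forall>n. 0 \<le> t n) \<and> coord v = (\<lambda>n. of_real (t n))" by blast
next
  assume "\<exists>t. (\<forall>n. 0 \<le> t n) \<and> coord v = (\<lambda>n. of_real (t n))"
  then show "v \<in> basis_cone x"
    using sums_coord[of v] by (auto simp: basis_cone_def smul_of_real)
qed

lemma basis_cone_add:
  assumes "u \<in> basis_cone x" "v \<in> basis_cone x"
  shows "u + v \<in> basis_cone x"
proof -
  obtain s t where "\<forall>n. 0 \<le> s n" "coord u = (\<lambda>n. of_real (s n))"
    "\<forall>n. 0 \<le> t n" "coord v = (\<lambda>n. of_real (t n))"
    using assms by (auto simp: basis_cone_iff)
  then show ?thesis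
    unfolding basis_cone_iff coord_add by (intro exI[of _ "\<lambda>n. s n + t n"]) simp
qed

lemma basis_cone_scaleR:
  assumes "0 \<le> c" "v \<in> basis_cone x"
  shows "c *\<^sub>R v \<in> basis_cone x"
proof -
  obtain t where "\<forall>n. 0 \<le> t n" "coord v = (\<lambda>n. of_real (t n))"
    using assms(2) by (auto simp: basis_cone_iff)
  then show ?thesis
    unfolding basis_cone_iff coord_scaleR using assms(1)
    by (intro exI[of _ "\<lambda>n. c * t n"]) (simp add: scaleR_conv_of_real)
qed

lemma basis_in_basis_cone: "x k \<in> basis_cone x"
  unfolding basis_cone_iff coord_basis by (rule exI[of _ "\<lambda>n. if n = k then 1 else 0"]) auto

lemma basis_cone_split_coord:
  assumes "v \<in> basis_cone x"
  obtains c where "0 \<le> c" "coord v k = of_real c" "v - c *\<^sub>R x k \<in> basis_cone x"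
proof -
  obtain t where t: "\<forall>n. 0 \<le> t n" "coord v = (\<lambda>n. of_real (t n))"
    using assms by (auto simp: basis_cone_iff)
  have "coord (v - t k *\<^sub>R x k) = (\<lambda>n. of_real (if n = k then 0 else t n))"
    by (auto simp: t(2) coord_diff coord_scaleR coord_basis scaleR_conv_of_real)
  then have "v - t k *\<^sub>R x k \<in> basis_cone x"
    unfolding basis_cone_iff using t(1) by (intro exI[of _ "\<lambda>n. if n = k then 0 else t n"]) auto
  then show ?thesis by (intro that[of "t k"]) (use t(1) in \<open>simp_all add: t(2)\<close>)
qed

section \<open>Invariant subspaces\<close>

text \<open>
  A vector of the cone with nonzero \<open>k\<close>-th coordinate dominates a positive multiple of \<open>x k\<close>. If \<open>a\<close>
  is the diagonal coefficient of a positive operator \<open>A\<close> at \<open>x k\<close>, the \<open>k\<close>-th coordinate of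
  \<open>(A ^^ m) y\<close> therefore grows at least like \<open>a ^ m\<close>. Taking \<open>d = a / 2\<close> in the decay hypothesis
  contradicts this unless \<open>a = 0\<close>.
\<close>
lemma diagonal_coord_zero:
  assumes A: "linear A" "A ` basis_cone x \<subseteq> basis_cone x"
    and y: "y \<in> basis_cone x" "coord y k \<noteq> 0"
    and decay: "\<And>d. d > 0 \<Longrightarrow> \<forall>\<^sub>F m in sequentially. norm ((A ^^ m) y) \<le> d ^ m"
  shows "coord (A (x k)) k = 0"
proof -
  obtain c where c: "0 \<le> c" "coord y k = of_real c" "y - c *\<^sub>R x k \<in> basis_cone x"
    using basis_cone_split_coord[OF y(1)] .
  have "c > 0" using c y(2) by (cases "c = 0") auto
  have "A (x k) \<in> basis_cone x" using A(2) basis_in_basis_cone by blast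
  then obtain a where a: "0 \<le> a" "coord (A (x k)) k = of_real a" "A (x k) - a *\<^sub>R x k \<in> basis_cone x"
    using basis_cone_split_coord by blast
  have dom: "(A ^^ m) y - (c * a ^ m) *\<^sub>R x k \<in> basis_cone x" for m
  proof (induction m)
    case (Suc m)
    have "A ((A ^^ m) y - (c * a ^ m) *\<^sub>R x k) + (c * a ^ m) *\<^sub>R (A (x k) - a *\<^sub>R x k)
        \<in> basis_cone x"
      using Suc A(2) a c by (intro basis_cone_add basis_cone_scaleR) auto
    then show ?case using A(1)
      by (simp add: linear_diff linear_cmul scaleR_diff_right mult_ac)
  qed (use c in simp)
  obtain K where K: "K > 0" "\<And>v. norm (coord v k) \<le> norm v * K"
    using bounded_linear.pos_bounded[OF coord_bounded_linear] by blast
  have growth: "c * a ^ m \<le> norm ((A ^^ m) y) * K" for m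
  proof -
    obtain b where b: "0 \<le> b" "coord ((A ^^ m) y - (c * a ^ m) *\<^sub>R x k) k = of_real b"
      using basis_cone_split_coord[OF dom] .
    then have "coord ((A ^^ m) y) k = of_real (b + c * a ^ m)"
      by (simp add: coord_diff coord_scaleR coord_basis scaleR_conv_of_real algebra_simps)
    then have "norm (coord ((A ^^ m) y) k) = b + c * a ^ m"
      using a b c by (simp flip: of_real_add of_real_mult of_real_power)
    then show ?thesis using K(2)[of "(A ^^ m) y"] b by linarith
  qed
  have "a = 0"
  proof (rule ccontr)
    assume "a \<noteq> 0"
    then have "a > 0" using a by simp
    then have "\<forall>\<^sub>F m in sequentially. norm ((A ^^ m) y) \<le> (a / 2) ^ m" by (intro decay) simp
    moreover have "\<forall>\<^sub>F m in sequentially. (1 / 2) ^ m < c / K"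
      using \<open>c > 0\<close> K(1) by (intro order_tendstoD(2)[OF LIMSEQ_power_zero]) auto
    ultimately have "\<forall>\<^sub>F m::nat in sequentially. False"
    proof eventually_elim
      case (elim m)
      have "c * a ^ m \<le> (a / 2) ^ m * K"
        using growth[of m] elim(1) K(1) by (meson mult_right_mono less_imp_le order_trans)
      then have "c / K \<le> (1 / 2) ^ m" using \<open>a > 0\<close> K(1) by (simp add: power_divide field_simps)
      with elim(2) show ?case by simp
    qed
    then show False by simp
  qed
  then show ?thesis using a by simp
qed

text \<open>
  Both invariant subspaces of the theorem have this form: \<open>W\<close> consists of all nonempty words for
  one of them and of the empty word alone for the other.
\<close>
lemma annihilator_closed_subspace:
  assumes "\<And>w. w \<in> W \<Longrightarrow> Vector_Spaces.linear smul smul (F w)"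
    and "\<And>w. w \<in> W \<Longrightarrow> continuous_on UNIV (F w)"
  shows "closed {v. \<forall>w\<in>W. coord (F w v) k = 0}" "subspace {v. \<forall>w\<in>W. coord (F w v) k = 0}"
proof -
  have "closed {v. coord (F w v) k = 0}" if "w \<in> W" for w
    using assms(2)[OF that]
    by (intro closed_Collect_eq bounded_linear.continuous_on[OF coord_bounded_linear]) simp_all
  then have "closed (\<Inter>w\<in>W. {v. coord (F w v) k = 0})" by (intro closed_INT ballI)
  then show "closed {v. \<forall>w\<in>W. coord (F w v) k = 0}" by (simp add: Collect_ball_eq)
  have hom: "module_hom smul smul (F w)" if "w \<in> W" for w
    using assms(1)[OF that] by (simp only: module_hom_iff_linear)
  have coord_zero: "coord 0 k = 0"
    using linear_0[OF bounded_linear.linear[OF coord_bounded_linear]] .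
  show "subspace {v. \<forall>w\<in>W. coord (F w v) k = 0}"
  proof (rule subspaceI)
    show "0 \<in> {v. \<forall>w\<in>W. coord (F w v) k = 0}"
      using module_hom.zero[OF hom] coord_zero by simp
  qed (auto simp: module_hom.add[OF hom] module_hom.scale[OF hom] coord_add coord_smul)
qed

end

text \<open>The shift by one in the index is due to sequences of letters being indexed from 1.\<close>
lemma foldr_map_periodic:
  assumes "w \<noteq> []"
  shows "foldr T (map (\<lambda>j. w ! ((j - 1) mod length w)) [1..<Suc (m * length w)]) = foldr T w ^^ m"
proof (induction m)
  case (Suc m)
  let ?i = "\<lambda>j. w ! ((j - 1) mod length w)" and ?n = "m * length w"
  have "[1..<Suc (Suc m * length w)] = [1..<Suc ?n] @ [Suc ?n..<Suc ?n + length w]"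
    using upt_add_eq_append[of 1 "Suc ?n" "length w"] by (simp add: add.commute)
  moreover have "map ?i [Suc ?n..<Suc ?n + length w] = w"
    by (rule nth_equalityI) (simp_all del: upt_Suc)
  ultimately show ?case using Suc by (simp add: funpow_Suc_right fun_eq_iff del: funpow.simps upt_Suc)
qed (simp add: fun_eq_iff)

text \<open>
  Apply quasinilpotence to the periodic sequence that repeats the word \<open>w\<close>, at the multiples
  of the length \<open>L\<close> of \<open>w\<close>. There the roots are of order \<open>m * L\<close> rather than \<open>m\<close>.
  Bounding them by a number that is at most \<open>1\<close> as well as at most \<open>d\<close> makes the factor \<open>L\<close>
  harmless.
\<close>
lemma joint_locally_quasinilpotent_word:
  assumes "joint_locally_quasinilpotent N T y" "w \<noteq> []" "set w \<subseteq> {1..N}" "d > 0"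
  shows "\<forall>\<^sub>F m in sequentially. norm ((foldr T w ^^ m) y) \<le> d ^ m"
proof -
  let ?L = "length w" and ?e = "min d 1"
  have L: "?L > 0" using assms(2) by simp
  have "w ! ((j - 1) mod ?L) \<in> {1..N}" for j
    using assms(3) L by (meson mod_less_divisor nth_mem subset_iff)
  then have lim: "(\<lambda>n. root n (norm (foldr T (map (\<lambda>j. w ! ((j - 1) mod ?L)) [1..<Suc n]) y))) \<longlonglongrightarrow> 0"
    using assms(1)[unfolded joint_locally_quasinilpotent_def, rule_format,
        of "\<lambda>j. w ! ((j - 1) mod ?L)"] by blast
  have "strict_mono (\<lambda>m. m * ?L)" using L by (simp add: strict_mono_def)
  from LIMSEQ_subseq_LIMSEQ[OF lim this]
  have "(\<lambda>m. root (m * ?L) (norm ((foldr T w ^^ m) y))) \<longlonglongrightarrow> 0"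
    by (simp only: o_def foldr_map_periodic[OF assms(2)])
  moreover have "0 < ?e" using assms(4) by simp
  ultimately have "\<forall>\<^sub>F m in sequentially. root (m * ?L) (norm ((foldr T w ^^ m) y)) < ?e"
    by (rule order_tendstoD)
  then show ?thesis using eventually_gt_at_top[of 0]
  proof eventually_elim
    case (elim m)
    let ?a = "norm ((foldr T w ^^ m) y)"
    have "?a = root (m * ?L) ?a ^ (m * ?L)" using elim L by (simp add: real_root_pow_pos2)
    also have "\<dots> \<le> ?e ^ (m * ?L)" using elim L by (intro power_mono) (auto simp: real_root_ge_zero)
    also have "\<dots> \<le> ?e ^ m" using assms(2,4) by (intro power_decreasing) (auto simp: Suc_le_eq)
    also have "\<dots> \<le> d ^ m" using assms(4) by (intro power_mono) auto
    finally show ?case .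
  qed
qed

theorem theorem3p1:
  fixes smul :: "'k::real_or_complex \<Rightarrow> 'a::banach \<Rightarrow> 'a"
    and x :: "nat \<Rightarrow> 'a" and N :: nat and T :: "nat \<Rightarrow> 'a \<Rightarrow> 'a" and y0 :: 'a
  assumes "normed_space_over smul"
    and "schauder_basis smul x"
    and "\<And>j. j \<in> {1..N} \<Longrightarrow> Vector_Spaces.linear smul smul (T j)"
    and "\<And>j. j \<in> {1..N} \<Longrightarrow> continuous_on UNIV (T j)"
    and "positive_tuple N T (basis_cone x)"
    and "y0 \<in> basis_cone x" and "y0 \<noteq> 0"
    and "joint_locally_quasinilpotent N T y0"
  shows "\<exists>M. common_nontrivial_invariant_subspace smul N T M"
proof -
  interpret normed_space_over smul by fact
  interpret banach_space_with_basis smul x by unfold_locales fact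
  have word: "Vector_Spaces.linear smul smul (foldr T w) \<and> continuous_on UNIV (foldr T w) \<and>
      foldr T w ` basis_cone x \<subseteq> basis_cone x" if "set w \<subseteq> {1..N}" for w
    using that
  proof (induction w)
    case Nil
    then show ?case by (simp add: linear_id[unfolded id_def])
  next
    case (Cons j w)
    have "foldr T (j # w) = T j \<circ> foldr T w" by simp
    moreover have "Vector_Spaces.linear smul smul (T j \<circ> foldr T w)"
      using Cons assms(3)[of j] by (intro Vector_Spaces.linear_compose) auto
    moreover have "continuous_on UNIV (T j \<circ> foldr T w)"
      using Cons assms(4)[of j] by (intro continuous_on_compose) (auto intro: continuous_on_subset)
    moreover have "(T j \<circ> foldr T w) ` basis_cone x \<subseteq> basis_cone x"
      using Cons assms(5) by (fastforce simp: positive_tuple_def image_subset_iff)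
    ultimately show ?case by metis
  qed
  have "\<exists>k. coord y0 k \<noteq> 0"
  proof (rule ccontr)
    assume "\<nexists>k. coord y0 k \<noteq> 0"
    then have "(\<lambda>n. 0) sums y0" using sums_coord[of y0] by simp
    then show False using assms(7) sums_unique2[OF sums_zero] by metis
  qed
  then obtain k where k: "coord y0 k \<noteq> 0" ..
  define W where "W = {w. w \<noteq> [] \<and> set w \<subseteq> {1..N}}"
  have xk: "coord (foldr T w (x k)) k = 0" if "w \<in> W" for w
  proof (rule diagonal_coord_zero[OF _ _ assms(6) k])
    have "Vector_Spaces.linear smul smul (foldr T w)" using word that by (simp add: W_def)
    then have hom: "module_hom smul smul (foldr T w)" by (simp add: module_hom_iff_linear)
    show "linear (foldr T w)"
    proof (rule linearI)
      show "foldr T w (r *\<^sub>R v) = r *\<^sub>R foldr T w v" for r v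
        using module_hom.scale[OF hom, of "of_real r" v] by (simp add: smul_of_real)
    qed (rule module_hom.add[OF hom])
  qed (use that word joint_locally_quasinilpotent_word[OF assms(8)] in \<open>auto simp: W_def\<close>)
  define M where "M = {v. \<forall>w\<in>W. coord (foldr T w v) k = 0}"
  have M: "closed M" "subspace M"
    unfolding M_def by (rule annihilator_closed_subspace; use word in \<open>simp add: W_def\<close>)+
  (* foldr T w (T j v) is the value at v of the product along the longer word w @ [j]. *)
  have inv: "T j ` M \<subseteq> M" if "j \<in> {1..N}" for j
  proof -
    have "w @ [j] \<in> W" if "w \<in> W" for w using that \<open>j \<in> {1..N}\<close> by (auto simp: W_def)
    then show ?thesis by (force simp: M_def)
  qed
  show ?thesis
  proof (cases "M = UNIV")
    case False
    have "x k \<in> M" using xk by (simp add: M_def)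
    then have "M \<noteq> {0}" using basis_nonzero by blast
    then show ?thesis
      using M inv False unfolding common_nontrivial_invariant_subspace_def by blast
  next
    case True
    (* Here the words with a single letter show that every operator maps into the kernel H. *)
    define H where "H = {v. coord v k = 0}"
    have "closed H" "subspace H"
      using annihilator_closed_subspace[of "{[]}" "foldr T" k] word[of "[]"]
      by (simp_all add: H_def)
    moreover have "x (Suc k) \<in> H" "x k \<notin> H" by (simp_all add: H_def coord_basis)
    then have "H \<noteq> {0}" "H \<noteq> UNIV" using basis_nonzero by blast+
    moreover have "T j v \<in> H" if "j \<in> {1..N}" for j v
    proof -
      have "[j] \<in> W" "v \<in> M" using that True by (simp_all add: W_def)
      then show ?thesis by (force simp: M_def H_def)
    qed
    ultimately show ?thesis
      by (intro exI[of _ H]) (auto simp: common_nontrivial_invariant_subspace_def)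
  qed
qed

end
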